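(* For a fixed ribbon structure, whether the Jaeger trees induce a triangulation may depend on the choice of basis: there exist a connected semi-balanced directed graph $G$, a ribbon structure on $G$, and two bases for it, such that the simplices $\mathcal{Q}_T$ of the Jaeger trees $T$ for the first basis form a triangulation of $\mathcal{Q}_G$, while those of the Jaeger trees for the second basis (with the same ribbon structure) do not form a triangulation of $\mathcal{Q}_G$.
   Context: A directed graph is an orientation of a finite graph without loops and multiple edges; $\overrightarrow{th}$ denotes an edge with tail $t$ and head $h$, and $xy$ an edge whose orientation is not specified. Connectedness, cycles and spanning trees are meant in the underlying undirected graph. A directed graph is semi-balanced if each of its cycles has the same number of edges going in the two directions around the cycle. For $G=(V,E)$ let $\mathbf{v}\in\mathbf{R}^V$ be the standard basis vector of $v\in V$. The root polytope is $\mathcal{Q}_G=\mathrm{Conv}\{\mathbf{h}-\mathbf{t}\mid \overrightarrow{th}\in E\}$; for a spanning tree $T$, $\mathcal{Q}_T=\mathrm{Conv}\{\mathbf{h}-\mathbf{t}\mid \overrightarrow{th}\in T\}$ (a simplex). A ribbon structure on $G$ is a choice, for each vertex $x$, of a cyclic permutation of the edges incident to $x$; $xy^+$ denotes the edge following $xy$ at $x$. A basis is a pair $(b_0,b_0b_1)$ where $b_0$ is a vertex and $b_0b_1$ is an edge incident to $b_0$. The tour of a spanning tree $T$ is the sequence of node-edge pairs starting with $(b_0,b_0b_1)$ such that if the current pair is $(x,xy)$ and $xy\notin T$ then the next pair is $(x,xy^+)$, while if $xy\in T$ then the next pair is $(y,yx^+)$; it stops right before $(b_0,b_0b_1)$ would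 become current again. A spanning tree $T$ is a Jaeger tree if for each edge $\overrightarrow{th}\notin T$ the pair $(t,th)$ precedes $(h,th)$ in the tour of $T$. For a connected semi-balanced graph with any ribbon structure and basis, the simplices $\mathcal{Q}_T$ of Jaeger trees form a dissection of $\mathcal{Q}_G$ (mutually interior-disjoint maximal dimensional simplices with union $\mathcal{Q}_G$). A dissection is a triangulation if any two of its simplices intersect in a (possibly empty) common face. *)

theory Defs
  imports "HOL-Analysis.Analysis" "HOL-Analysis.Finite_Function_Topology" "Graph_Theory.Digraph_Component" "HOL-Combinatorics.Orbits"
begin

section \<open>Directed graphs\<close>

text \<open>
  A directed graph is a \<^typ>\<open>'a pair_pre_digraph\<close>; the arc \<open>(t, h)\<close> has tail \<open>t\<close> and head \<open>h\<close>.
  The locale \<^locale>\<open>pair_digraph\<close> gives finiteness and absence of loops, and antisymmetry of the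
  arc relation says that an edge of the underlying graph is oriented in one direction only.
\<close>

definition directed_graph :: "'a pair_pre_digraph \<Rightarrow> bool" where
  "directed_graph G \<longleftrightarrow>
     pair_digraph G \<and> (\<forall>t h. (t, h) \<in> parcs G \<longrightarrow> (h, t) \<notin> parcs G)"

text \<open>
  A cycle of the underlying undirected graph, given as a closed walk that may traverse arcs in
  either direction. The constraint on the length excludes walking back and forth along one edge,
  which counts as a cycle for \<^const>\<open>pre_digraph.cycle\<close>.
\<close>

definition undirected_cycle :: "'a pair_pre_digraph \<Rightarrow> ('a \<times> 'a) list \<Rightarrow> bool" where
  "undirected_cycle G p \<longleftrightarrow>
     pre_digraph.cycle (with_proj (mk_symmetric (with_proj G))) p \<and> 3 \<le> length p"

definition semi_balanced :: "'a pair_pre_digraph \<Rightarrow> bool" where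
  "semi_balanced G \<longleftrightarrow>
     (\<forall>p. undirected_cycle G p \<longrightarrow>
        length (filter (\<lambda>(x, y). (x, y) \<in> parcs G) p) =
        length (filter (\<lambda>(x, y). (y, x) \<in> parcs G) p))"

text \<open>
  \<^const>\<open>Digraph_Component.connected\<close> refers to the underlying undirected graph, but
  \<^const>\<open>Digraph_Component.spanning_tree\<close> only forbids directed cycles and is therefore not used.
  A spanning tree is identified with its set of arcs.
\<close>

definition is_spanning_tree :: "'a pair_pre_digraph \<Rightarrow> ('a \<times> 'a) set \<Rightarrow> bool" where
  "is_spanning_tree G T \<longleftrightarrow>
     T \<subseteq> parcs G \<and>
     Digraph_Component.connected (with_proj \<lparr>pverts = pverts G, parcs = T\<rparr>) \<and>
     \<not> (\<exists>p. undirected_cycle \<lparr>pverts = pverts G, parcs = T\<rparr> p)"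


section \<open>Ribbon structures, tours and Jaeger trees\<close>

definition incident_edges :: "'a pair_pre_digraph \<Rightarrow> 'a \<Rightarrow> ('a \<times> 'a) set" where
  "incident_edges G x = {e \<in> parcs G. fst e = x \<or> snd e = x}"

definition other_end :: "'a \<Rightarrow> 'a \<times> 'a \<Rightarrow> 'a" where
  "other_end x e = (if fst e = x then snd e else fst e)"

text \<open>\<open>\<rho> x e\<close> is the edge \<open>e\<^sup>+\<close> following \<open>e\<close> at \<open>x\<close>.
  (\<^const>\<open>cyclic_on\<close> is never true of the empty set.)\<close>

definition ribbon_structure :: "'a pair_pre_digraph \<Rightarrow> ('a \<Rightarrow> 'a \<times> 'a \<Rightarrow> 'a \<times> 'a) \<Rightarrow> bool" where
  "ribbon_structure G \<rho> \<longleftrightarrow>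
     (\<forall>x \<in> pverts G. \<rho> x permutes incident_edges G x \<and>
        (incident_edges G x \<noteq> {} \<longrightarrow> cyclic_on (\<rho> x) (incident_edges G x)))"

definition is_basis :: "'a pair_pre_digraph \<Rightarrow> 'a \<times> ('a \<times> 'a) \<Rightarrow> bool" where
  "is_basis G b \<longleftrightarrow> fst b \<in> pverts G \<and> snd b \<in> incident_edges G (fst b)"

definition tour_step ::
  "('a \<Rightarrow> 'a \<times> 'a \<Rightarrow> 'a \<times> 'a) \<Rightarrow> ('a \<times> 'a) set \<Rightarrow> 'a \<times> ('a \<times> 'a) \<Rightarrow> 'a \<times> ('a \<times> 'a)" where
  "tour_step \<rho> T = (\<lambda>(x, e).
     if e \<in> T then (other_end x e, \<rho> (other_end x e) e) else (x, \<rho> x e))"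

definition tour ::
  "('a \<Rightarrow> 'a \<times> 'a \<Rightarrow> 'a \<times> 'a) \<Rightarrow> 'a \<times> ('a \<times> 'a) \<Rightarrow> ('a \<times> 'a) set \<Rightarrow> ('a \<times> ('a \<times> 'a)) list" where
  "tour \<rho> b T =
     map (\<lambda>i. (tour_step \<rho> T ^^ i) b) [0 ..< (LEAST n. 0 < n \<and> (tour_step \<rho> T ^^ n) b = b)]"

definition precedes_in :: "'b list \<Rightarrow> 'b \<Rightarrow> 'b \<Rightarrow> bool" where
  "precedes_in xs a b \<longleftrightarrow> (\<exists>i j. i < j \<and> j < length xs \<and> xs ! i = a \<and> xs ! j = b)"

definition jaeger_tree ::
  "'a pair_pre_digraph \<Rightarrow> ('a \<Rightarrow> 'a \<times> 'a \<Rightarrow> 'a \<times> 'a) \<Rightarrow> 'a \<times> ('a \<times> 'a) \<Rightarrow> ('a \<times> 'a) set \<Rightarrow> bool" where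
  "jaeger_tree G \<rho> b T \<longleftrightarrow>
     is_spanning_tree G T \<and>
     (\<forall>(t, h) \<in> parcs G - T. precedes_in (tour \<rho> b T) (t, (t, h)) (h, (t, h)))"


section \<open>Root polytopes and triangulations\<close>

text \<open>
  The space \<open>\<real>\<^sup>V\<close> is realised inside the normed space of finitely supported functions on the
  vertex type, as those supported on \<open>V\<close>. The notions below do not depend on the ambient space,
  so that no finite type of vertices has to be fixed.
\<close>

definition edge_vector :: "'a \<times> 'a \<Rightarrow> 'a \<Rightarrow>\<^sub>0 real" where
  "edge_vector = (\<lambda>(t, h). Poly_Mapping.single h 1 - Poly_Mapping.single t 1)"

definition root_polytope :: "('a \<times> 'a) set \<Rightarrow> ('a \<Rightarrow>\<^sub>0 real) set" where
  "root_polytope A = convex hull (edge_vector ` A)"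

text \<open>
  The library's \<^const>\<open>simplex\<close>, \<^const>\<open>aff_dim\<close> and \<^const>\<open>triangulation\<close> require a Euclidean
  space, hence the following versions for real vector spaces.
\<close>

definition is_simplex :: "'b::real_vector set \<Rightarrow> bool" where
  "is_simplex S \<longleftrightarrow>
     (\<exists>C. finite C \<and> C \<noteq> {} \<and> \<not> affine_dependent C \<and> S = convex hull C)"

text \<open>Dimension of the affine hull, for non-empty sets.\<close>

definition affine_dimension :: "'b::real_vector set \<Rightarrow> nat" where
  "affine_dimension S = dim {x - y |x y. x \<in> S \<and> y \<in> S}"

definition dissection_of :: "'b::real_normed_vector set set \<Rightarrow> 'b set \<Rightarrow> bool" where
  "dissection_of \<S> P \<longleftrightarrow>
     finite \<S> \<and>
     (\<forall>S \<in> \<S>. is_simplex S \<and> affine_dimension S = affine_dimension P) \<and>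
     pairwise (\<lambda>S S'. rel_interior S \<inter> rel_interior S' = {}) \<S> \<and>
     \<Union>\<S> = P"

definition triangulation_of :: "'b::real_normed_vector set set \<Rightarrow> 'b set \<Rightarrow> bool" where
  "triangulation_of \<S> P \<longleftrightarrow>
     dissection_of \<S> P \<and>
     (\<forall>S \<in> \<S>. \<forall>S' \<in> \<S>. S \<inter> S' face_of S \<and> S \<inter> S' face_of S')"

definition jaeger_simplices ::
  "'a pair_pre_digraph \<Rightarrow> ('a \<Rightarrow> 'a \<times> 'a \<Rightarrow> 'a \<times> 'a) \<Rightarrow> 'a \<times> ('a \<times> 'a) \<Rightarrow> ('a \<Rightarrow>\<^sub>0 real) set set" where
  "jaeger_simplices G \<rho> b = root_polytope ` {T. jaeger_tree G \<rho> b T}"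

end

theory Submission
  imports Defs "HOL-Combinatorics.Cycles"
begin

text \<open>
  The example is the complete bipartite graph on \<open>{0, 4}\<close> and \<open>{1, 2, 3}\<close>,
  oriented as three directed paths \<open>0 \<rightarrow> i \<rightarrow> 4\<close>. Every arc goes
  up by one level, so each cycle has as many forward as backward edges. The two edge vectors of the
  path through \<open>i\<close> add up to the difference of the basis vectors of \<open>4\<close>
  and \<open>0\<close> for every \<open>i\<close>; up to this they are independent, so the root
  polytope is an octahedron whose three diagonals are the three paths. A spanning tree contains
  exactly one path completely and one edge of each of the other two, so its simplex consists of one
  diagonal and one end of each of the other diagonals.

  At \<open>0\<close> and at \<open>4\<close> the edges are ordered cyclically by their middle
  vertices. Both bases are at the vertex \<open>1\<close> and differ in the edge.

  Starting with the edge \<open>01\<close>, the pair \<open>(1, 01)\<close> is the first of every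
  tour. As \<open>1\<close> is the head of \<open>01\<close>, this edge violates the Jaeger
  condition unless it is in the tree; and \<open>(1, 14)\<close> would be the last pair of the tour
  if \<open>14\<close> were not in the tree (\<open>base_edge_in_jaeger_tree\<close>,
  \<open>edge_before_base_in_jaeger_tree\<close>). So all Jaeger trees contain the path through
  \<open>1\<close>. All four spanning trees of this kind are Jaeger trees, and the four tetrahedra
  around one diagonal triangulate the octahedron (\<open>octahedron.triangulation_cells\<close>):
  they are cut out of it by the signs of the two other coordinates.

  Starting with the edge \<open>14\<close>, there are Jaeger trees containing different paths:
  \<open>01, 02, 03, 34\<close> and \<open>02, 03, 14, 24\<close>. Both of their simplices contain
  the centre of the octahedron, which lies in the interior of the diagonal \<open>03, 34\<close> of
  the first one. A common face containing the centre would thus contain \<open>34\<close>, but the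
  second simplex does not.
\<close>

section \<open>Triangulating an octahedron along a diagonal\<close>

lemma linear_zero_face_of:
  fixes f :: "'v::real_vector \<Rightarrow> real"
  assumes "linear f" "convex S" and nonneg: "\<And>x. x \<in> S \<Longrightarrow> 0 \<le> f x"
  shows "S \<inter> {x. f x = 0} face_of S"
  unfolding face_of_def
proof (intro conjI ballI impI)
  interpret linear f by fact
  show "S \<inter> {x. f x = 0} \<subseteq> S" by simp
  have "convex {x. f x = 0}"
    by (auto simp: convex_def add scale)
  then show "convex (S \<inter> {x. f x = 0})"
    using assms(2) by (rule convex_Int[rotated])
  fix a b x
  assume a: "a \<in> S" and b: "b \<in> S" and x: "x \<in> S \<inter> {x. f x = 0}" "x \<in> open_segment a b"
  obtain u where u: "0 < u" "u < 1" "x = (1 - u) *\<^sub>R a + u *\<^sub>R b"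
    using x(2) by (auto simp: in_segment)
  then have "(1 - u) * f a + u * f b = 0"
    using x(1) by (simp add: add scale)
  moreover have "0 \<le> (1 - u) * f a" "0 \<le> u * f b"
    using u nonneg[OF a] nonneg[OF b] by auto
  ultimately have "(1 - u) * f a = 0" "u * f b = 0"
    by linarith+
  then have "f a = 0" "f b = 0"
    using u by auto
  then show "a \<in> S \<inter> {x. f x = 0}" "b \<in> S \<inter> {x. f x = 0}"
    using a b by auto
qed

lemma disjoint_rel_interior_if_Int_proper_face:
  fixes S S' :: "'v::real_normed_vector set"
  assumes "S \<inter> S' face_of S" "\<not> S \<subseteq> S'"
  shows "rel_interior S \<inter> rel_interior S' = {}"
  using face_of_disjoint_rel_interior[OF assms(1)] assms(2) rel_interior_subset[of S] rel_interior_subset[of S'] by blast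

definition unit_sign :: "bool \<Rightarrow> real" where
  "unit_sign a = (if a then 1 else - 1)"

lemma unit_sign_simps [simp]: "unit_sign True = 1" "unit_sign False = - 1" "\<bar>unit_sign a\<bar> = 1" "unit_sign a * unit_sign a = 1"
  by (auto simp: unit_sign_def)

text \<open>
  The octahedron with centre \<open>c\<close> and vertices \<open>c \<plusminus> d i\<close>.
  Instead of the linear independence of the half diagonals, the locale provides dual coordinates,
  which make membership in the solid and in its pieces a matter of inequalities.
\<close>

locale octahedron =
  fixes c :: "'v::real_normed_vector" and d :: "nat \<Rightarrow> 'v" and coord :: "nat \<Rightarrow> 'v \<Rightarrow> real"
  assumes linear_coord: "i \<in> {1, 2, 3} \<Longrightarrow> linear (coord i)"
    and coord_c: "i \<in> {1, 2, 3} \<Longrightarrow> coord i c = 0"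
    and coord_d: "i \<in> {1, 2, 3} \<Longrightarrow> j \<in> {1, 2, 3} \<Longrightarrow> coord i (d j) = of_bool (i = j)"
begin

definition apex :: "bool \<Rightarrow> nat \<Rightarrow> 'v" where
  "apex a i = c + unit_sign a *\<^sub>R d i"

definition solid :: "'v set" where
  "solid = convex hull {apex a i | a i. i \<in> {1, 2, 3}}"

definition cell :: "bool \<Rightarrow> bool \<Rightarrow> 'v set" where
  "cell a b = convex hull {apex True 1, apex False 1, apex a 2, apex b 3}"

text \<open>The unit ball of the \<open>\<ell>\<^sub>1\<close> norm in the coordinates around \<open>c\<close>. It describes \<open>solid\<close> by inequalities.\<close>

definition coord_solid :: "'v set" where
  "coord_solid = {x. x = c + coord 1 x *\<^sub>R d 1 + coord 2 x *\<^sub>R d 2 + coord 3 x *\<^sub>R d 3 \<and>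
     \<bar>coord 1 x\<bar> + \<bar>coord 2 x\<bar> + \<bar>coord 3 x\<bar> \<le> 1}"

lemma coord_add: "i \<in> {1, 2, 3} \<Longrightarrow> coord i (x + y) = coord i x + coord i y"
  and coord_diff: "i \<in> {1, 2, 3} \<Longrightarrow> coord i (x - y) = coord i x - coord i y"
  and coord_scale: "i \<in> {1, 2, 3} \<Longrightarrow> coord i (r *\<^sub>R x) = r * coord i x"
  and coord_zero: "i \<in> {1, 2, 3} \<Longrightarrow> coord i 0 = 0"
  using linear_coord by (auto simp: linear_add linear_diff linear_cmul linear_0)

lemmas coord_simps = coord_add coord_diff coord_scale coord_zero coord_c coord_d

lemma coord_apex: "i \<in> {1, 2, 3} \<Longrightarrow> j \<in> {1, 2, 3} \<Longrightarrow> coord i (apex a j) = of_bool (i = j) * unit_sign a"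
  by (simp add: apex_def coord_simps)

lemma convex_halfspace: "i \<in> {1, 2, 3} \<Longrightarrow> convex {x. 0 \<le> r * coord i x}"
proof (unfold convex_def, intro ballI allI impI, unfold mem_Collect_eq)
  fix x y and u v :: real
  assume *: "i \<in> {1, 2, 3}" "0 \<le> r * coord i x" "0 \<le> r * coord i y" "0 \<le> u" "0 \<le> v"
  have "r * coord i (u *\<^sub>R x + v *\<^sub>R y) = u * (r * coord i x) + v * (r * coord i y)"
    using *(1) by (simp only: coord_add coord_scale) (simp add: algebra_simps)
  then show "0 \<le> r * coord i (u *\<^sub>R x + v *\<^sub>R y)"
    using * by simp
qed

lemma convex_coord_solid: "convex coord_solid"
  unfolding convex_def
proof (intro ballI allI impI)
  fix x y and u v :: real
  assume x: "x \<in> coord_solid" and y: "y \<in> coord_solid" and uv: "0 \<le> u" "0 \<le> v" "u + v = 1"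
  let ?z = "u *\<^sub>R x + v *\<^sub>R y"
  have z: "coord i ?z = u * coord i x + v * coord i y" if "i \<in> {1, 2, 3}" for i
    using that by (simp only: coord_add coord_scale)
  have "?z = u *\<^sub>R (c + coord 1 x *\<^sub>R d 1 + coord 2 x *\<^sub>R d 2 + coord 3 x *\<^sub>R d 3)
      + v *\<^sub>R (c + coord 1 y *\<^sub>R d 1 + coord 2 y *\<^sub>R d 2 + coord 3 y *\<^sub>R d 3)"
    using x y unfolding coord_solid_def by simp
  also have "\<dots> = (u + v) *\<^sub>R c + coord 1 ?z *\<^sub>R d 1 + coord 2 ?z *\<^sub>R d 2 + coord 3 ?z *\<^sub>R d 3"
    by (simp add: z algebra_simps)
  finally have eq: "?z = c + coord 1 ?z *\<^sub>R d 1 + coord 2 ?z *\<^sub>R d 2 + coord 3 ?z *\<^sub>R d 3"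
    by (simp add: uv)
  have abs: "\<bar>coord i ?z\<bar> \<le> u * \<bar>coord i x\<bar> + v * \<bar>coord i y\<bar>" if "i \<in> {1, 2, 3}" for i
    using uv abs_triangle_ineq[of "u * coord i x" "v * coord i y"] by (simp add: z[OF that] abs_mult)
  have "\<bar>coord 1 ?z\<bar> + \<bar>coord 2 ?z\<bar> + \<bar>coord 3 ?z\<bar> \<le>
      u * (\<bar>coord 1 x\<bar> + \<bar>coord 2 x\<bar> + \<bar>coord 3 x\<bar>) + v * (\<bar>coord 1 y\<bar> + \<bar>coord 2 y\<bar> + \<bar>coord 3 y\<bar>)"
    using abs[of 1] abs[of 2] abs[of 3] by (simp add: algebra_simps)
  also have "\<dots> \<le> 1"
    using x y uv by (intro convex_bound_le) (auto simp: coord_solid_def)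
  finally show "?z \<in> coord_solid"
    using eq by (simp add: coord_solid_def)
qed

lemma apex_in_coord_solid: "i \<in> {1, 2, 3} \<Longrightarrow> apex a i \<in> coord_solid"
  by (auto simp: coord_solid_def coord_apex) (simp_all add: apex_def)

lemma apex_in_solid: "i \<in> {1, 2, 3} \<Longrightarrow> apex a i \<in> solid"
  unfolding solid_def by (intro hull_inc) auto

lemma solid_subset: "solid \<subseteq> coord_solid"
  unfolding solid_def by (rule hull_minimal) (auto simp: convex_coord_solid intro!: apex_in_coord_solid)

lemma cell_subset_solid: "cell a b \<subseteq> solid"
  unfolding cell_def solid_def by (rule hull_mono) auto

text \<open>
  The coordinate planes of the two diagonals that are not used for cutting divide the octahedron
  into four pieces, which are the tetrahedra around the diagonal \<open>1\<close>. This description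
  makes it clear that they cover the octahedron, and that the intersection of two of them is cut out
  of either by supporting hyperplanes.
\<close>

lemma cell_eq:
  "cell a b = coord_solid \<inter> {x. 0 \<le> unit_sign a * coord 2 x} \<inter> {x. 0 \<le> unit_sign b * coord 3 x}"
proof (intro equalityI subsetI)
  fix x assume "x \<in> cell a b"
  moreover have "cell a b \<subseteq> {x. 0 \<le> unit_sign a * coord 2 x} \<inter> {x. 0 \<le> unit_sign b * coord 3 x}"
    unfolding cell_def
    by (rule hull_minimal) (auto simp: coord_apex intro!: convex_Int convex_halfspace)
  ultimately show "x \<in> coord_solid \<inter> {x. 0 \<le> unit_sign a * coord 2 x} \<inter> {x. 0 \<le> unit_sign b * coord 3 x}"
    using cell_subset_solid solid_subset by blast
next
  fix x assume x: "x \<in> coord_solid \<inter> {x. 0 \<le> unit_sign a * coord 2 x} \<inter> {x. 0 \<le> unit_sign b * coord 3 x}"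
  \<comment> \<open>barycentric coordinates: what the apexes on the diagonals 2 and 3 leave over is shared by the
    two ends of the diagonal 1, in such a way that the first coordinate comes out right\<close>
  define r where "r = 1 - unit_sign a * coord 2 x - unit_sign b * coord 3 x"
  have "\<bar>coord 2 x\<bar> = unit_sign a * coord 2 x" "\<bar>coord 3 x\<bar> = unit_sign b * coord 3 x"
    using x by (auto simp: unit_sign_def split: if_splits)
  then have r: "\<bar>coord 1 x\<bar> \<le> r"
    using x by (auto simp: coord_solid_def r_def)
  have eq: "x = c + coord 1 x *\<^sub>R d 1 + coord 2 x *\<^sub>R d 2 + coord 3 x *\<^sub>R d 3"
    using x by (simp add: coord_solid_def)
  have apexes: "apex True 1 \<in> cell a b" "apex False 1 \<in> cell a b" "apex a 2 \<in> cell a b" "apex b 3 \<in> cell a b"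
    unfolding cell_def by (auto intro: hull_inc)
  define v where "v = (!) [apex True 1, apex False 1, apex a 2, apex b 3]"
  define w where "w = (!) [(r + coord 1 x) / 2, (r - coord 1 x) / 2, unit_sign a * coord 2 x, unit_sign b * coord 3 x]"
  have "(\<Sum>i<4. w i *\<^sub>R v i) \<in> cell a b"
    using r x apexes
    by (intro convex_sum) (auto simp: cell_def v_def w_def r_def field_simps lessThan_nat_numeral)
  also have "(\<Sum>i<4. w i *\<^sub>R v i) = c + coord 1 x *\<^sub>R d 1 + coord 2 x *\<^sub>R d 2 + coord 3 x *\<^sub>R d 3"
  proof -
    have "(\<Sum>i<4. w i *\<^sub>R v i) = ((r + coord 1 x) / 2) *\<^sub>R (c + d 1) + ((r - coord 1 x) / 2) *\<^sub>R (c - d 1) +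
        (unit_sign a * coord 2 x) *\<^sub>R (c + unit_sign a *\<^sub>R d 2) +
        (unit_sign b * coord 3 x) *\<^sub>R (c + unit_sign b *\<^sub>R d 3)"
      by (simp add: v_def w_def apex_def numeral_eq_Suc)
    also have "\<dots> = ((r + coord 1 x) / 2 + (r - coord 1 x) / 2 + unit_sign a * coord 2 x + unit_sign b * coord 3 x) *\<^sub>R c +
        ((r + coord 1 x) / 2 - (r - coord 1 x) / 2) *\<^sub>R d 1 +
        ((unit_sign a * unit_sign a) * coord 2 x) *\<^sub>R d 2 + ((unit_sign b * unit_sign b) * coord 3 x) *\<^sub>R d 3"
      by (simp add: algebra_simps del: unit_sign_simps)
    also have "\<dots> = c + coord 1 x *\<^sub>R d 1 + coord 2 x *\<^sub>R d 2 + coord 3 x *\<^sub>R d 3"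
      by (simp add: r_def field_simps)
    finally show ?thesis .
  qed
  finally show "x \<in> cell a b"
    using eq by simp
qed

lemma apexes_subset_cell: "{apex True 1, apex False 1, apex a 2, apex b 3} \<subseteq> cell a b"
  unfolding cell_def by (rule hull_subset)

lemma centre_in_cell: "c \<in> cell a b"
  by (auto simp: cell_eq coord_solid_def coord_c)

lemma inj_apex:
  assumes "i \<in> {1, 2, 3}" "j \<in> {1, 2, 3}"
  shows "apex a i = apex b j \<longleftrightarrow> a = b \<and> i = j"
proof
  assume "apex a i = apex b j"
  then have "coord i (apex a i) = coord i (apex b j)"
    by simp
  then show "a = b \<and> i = j"
    using assms by (simp only: coord_apex) (auto simp: unit_sign_def split: if_splits)
qed simp

lemma affine_independent_apexes: "\<not> affine_dependent {apex True 1, apex False 1, apex a 2, apex b 3}"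
proof
  assume "affine_dependent {apex True 1, apex False 1, apex a 2, apex b 3}"
  then obtain u where sum: "sum u {apex True 1, apex False 1, apex a 2, apex b 3} = 0"
    and nz: "\<exists>v\<in>{apex True 1, apex False 1, apex a 2, apex b 3}. u v \<noteq> 0"
    and comb: "(\<Sum>v\<in>{apex True 1, apex False 1, apex a 2, apex b 3}. u v *\<^sub>R v) = 0"
    by (subst (asm) affine_dependent_explicit_finite) auto
  have comb': "u (apex True 1) *\<^sub>R apex True 1 + (u (apex False 1) *\<^sub>R apex False 1 +
     (u (apex a 2) *\<^sub>R apex a 2 + u (apex b 3) *\<^sub>R apex b 3)) = 0"
    using comb by (simp add: inj_apex)
  have "coord i (u (apex True 1) *\<^sub>R apex True 1 + (u (apex False 1) *\<^sub>R apex False 1 +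
     (u (apex a 2) *\<^sub>R apex a 2 + u (apex b 3) *\<^sub>R apex b 3))) = 0" if "i \<in> {1, 2, 3}" for i
    using that by (simp only: comb' coord_zero)
  from this[of 1] this[of 2] this[of 3]
  have "u (apex True 1) = u (apex False 1)" "u (apex a 2) = 0" "u (apex b 3) = 0"
    by (simp_all add: coord_simps coord_apex split: if_splits)  (auto simp: unit_sign_def split: if_splits)
  with sum nz show False
    by (simp add: inj_apex)
qed

lemma is_simplex_cell: "is_simplex (cell a b)"
  unfolding is_simplex_def
  by (rule exI[of _ "{apex True 1, apex False 1, apex a 2, apex b 3}"])
    (simp add: cell_def affine_independent_apexes del: One_nat_def)

text \<open>
  The centre and one end of each diagonal are enough for the differences to span the space of the
  half diagonals. This compares the tetrahedra with the whole octahedron by means of equal spans,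
  without computing a dimension.
\<close>

lemma affine_dimension_eq:
  assumes S: "S \<subseteq> coord_solid" "c \<in> S" and apex: "\<And>i. i \<in> {1, 2, 3} \<Longrightarrow> \<exists>a. apex a i \<in> S"
  shows "affine_dimension S = dim (d ` {1, 2, 3})"
proof -
  let ?D = "{x - y | x y. x \<in> S \<and> y \<in> S}"
  have "?D \<subseteq> span (d ` {1, 2, 3})"
  proof safe
    fix x y assume "x \<in> S" "y \<in> S"
    then have x: "x = c + coord 1 x *\<^sub>R d 1 + coord 2 x *\<^sub>R d 2 + coord 3 x *\<^sub>R d 3"
      and y: "y = c + coord 1 y *\<^sub>R d 1 + coord 2 y *\<^sub>R d 2 + coord 3 y *\<^sub>R d 3"
      using S by (auto simp: coord_solid_def)
    have "x - y = (c + coord 1 x *\<^sub>R d 1 + coord 2 x *\<^sub>R d 2 + coord 3 x *\<^sub>R d 3) -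
        (c + coord 1 y *\<^sub>R d 1 + coord 2 y *\<^sub>R d 2 + coord 3 y *\<^sub>R d 3)"
      using arg_cong2[of _ _ _ _ "(-)", OF x y] .
    also have "\<dots> = (coord 1 x - coord 1 y) *\<^sub>R d 1 + (coord 2 x - coord 2 y) *\<^sub>R d 2 +
        (coord 3 x - coord 3 y) *\<^sub>R d 3"
      by (simp add: algebra_simps)
    also have "\<dots> \<in> span (d ` {1, 2, 3})"
      by (intro span_add span_scale span_base) auto
    finally show "x - y \<in> span (d ` {1, 2, 3})" .
  qed
  moreover
  have "d i \<in> span ?D" if i: "i \<in> {1, 2, 3}" for i
  proof -
    obtain a where "apex a i \<in> S"
      using apex[OF i] by blast
    then have "apex a i - c \<in> span ?D"
      using S by (intro span_base) auto
    then have "unit_sign a *\<^sub>R (apex a i - c) \<in> span ?D"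
      by (rule span_scale)
    also have "unit_sign a *\<^sub>R (apex a i - c) = d i"
      by (simp add: apex_def)
    finally show ?thesis .
  qed
  then have "d ` {1, 2, 3} \<subseteq> span ?D"
    by (rule image_subsetI)
  ultimately have "span ?D = span (d ` {1, 2, 3})"
    by (intro subset_antisym span_minimal subspace_span)
  then have "dim (span ?D) = dim (span (d ` {1, 2, 3}))"
    by (rule arg_cong)
  then show ?thesis
    unfolding affine_dimension_def dim_span .
qed

lemma affine_dimension_cell: "affine_dimension (cell a b) = affine_dimension solid"
proof -
  have cell_in: "\<exists>s. apex s i \<in> cell a b" if i: "i \<in> {1, 2, 3}" for i
  proof -
    consider "i = 1" | "i = 2" | "i = 3" using i by blast
    then show ?thesis
      using apexes_subset_cell[of a b] by cases (simp_all only: insert_subset, blast+)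
  qed
  have "affine_dimension (cell a b) = dim (d ` {1, 2, 3})"
    by (rule affine_dimension_eq[OF subset_trans[OF cell_subset_solid solid_subset] centre_in_cell cell_in])
  moreover have "affine_dimension solid = dim (d ` {1, 2, 3})"
    by (rule affine_dimension_eq[OF solid_subset subsetD[OF cell_subset_solid centre_in_cell]])
      (use apex_in_solid in blast)
  ultimately show ?thesis by simp
qed

lemma Union_cells: "(\<Union>a b. cell a b) = solid"
proof
  show "(\<Union>a b. cell a b) \<subseteq> solid"
    using cell_subset_solid by blast
  show "solid \<subseteq> (\<Union>a b. cell a b)"
  proof
    fix x assume "x \<in> solid"
    then have "x \<in> cell (0 \<le> coord 2 x) (0 \<le> coord 3 x)"
      using solid_subset by (auto simp: cell_eq unit_sign_def)
    then show "x \<in> (\<Union>a b. cell a b)" by blast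
  qed
qed

text \<open>
  Where the signs of a coordinate differ, the intersection lies in the zero set of this coordinate;
  and where a linear function has constant sign on a convex set, its zero set cuts out a face.
\<close>

lemma cell_Int_face: "cell a b \<inter> cell a' b' face_of cell a b"
proof -
  have convex: "convex (cell a b)"
    by (simp add: cell_def)
  have lin: "linear (\<lambda>x. unit_sign s * coord i x)" if "i \<in> {1, 2, 3}" for s i
    using linear_coord[OF that] by (simp add: linear_iff algebra_simps)
  have F2: "cell a b \<inter> {x. unit_sign a * coord 2 x = 0} face_of cell a b"
    by (rule linear_zero_face_of[OF lin convex]) (auto simp: cell_eq)
  have F3: "cell a b \<inter> {x. unit_sign b * coord 3 x = 0} face_of cell a b"
    by (rule linear_zero_face_of[OF lin convex]) (auto simp: cell_eq)
  have F: "(if P then cell a b else cell a b \<inter> {x. unit_sign s * coord i x = 0}) face_of cell a b"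
    if "cell a b \<inter> {x. unit_sign s * coord i x = 0} face_of cell a b" for P s i
    using that face_of_refl[OF convex] by simp
  have "x \<in> cell a' b' \<longleftrightarrow> (a = a' \<or> unit_sign a * coord 2 x = 0) \<and> (b = b' \<or> unit_sign b * coord 3 x = 0)"
    if "x \<in> cell a b" for x
    using that by (cases a; cases a'; cases b; cases b') (auto simp: cell_eq)
  then have "cell a b \<inter> cell a' b' =
      (if a = a' then cell a b else cell a b \<inter> {x. unit_sign a * coord 2 x = 0}) \<inter>
      (if b = b' then cell a b else cell a b \<inter> {x. unit_sign b * coord 3 x = 0})"
    by auto
  then show ?thesis
    by (simp only: face_of_Int[OF F[OF F2] F[OF F3]])
qed

lemma cell_subset_iff: "cell a b \<subseteq> cell a' b' \<longleftrightarrow> a = a' \<and> b = b'"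
proof
  assume "cell a b \<subseteq> cell a' b'"
  then have "apex a 2 \<in> cell a' b'" "apex b 3 \<in> cell a' b'"
    using apexes_subset_cell[of a b] by blast+
  then show "a = a' \<and> b = b'"
    by (simp add: cell_eq coord_apex) (simp add: unit_sign_def split: if_splits)
qed simp

theorem triangulation_cells: "triangulation_of {cell a b | a b. True} solid"
  unfolding triangulation_of_def dissection_of_def
proof (intro conjI)
  have "{cell a b | a b. True} = (\<lambda>(a, b). cell a b) ` UNIV"
    by auto
  then show "finite {cell a b | a b. True}"
    by simp
  show "\<forall>S\<in>{cell a b | a b. True}. is_simplex S \<and> affine_dimension S = affine_dimension solid"
    using is_simplex_cell affine_dimension_cell by blast
  show "pairwise (\<lambda>S S'. rel_interior S \<inter> rel_interior S' = {}) {cell a b | a b. True}"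
    unfolding pairwise_def

  proof (intro ballI impI)
    fix S S' assume "S \<in> {cell a b | a b. True}" "S' \<in> {cell a b | a b. True}" "S \<noteq> S'"
    then obtain a b a' b' where S: "S = cell a b" "S' = cell a' b'" and "cell a b \<noteq> cell a' b'"
      by blast
    then have "\<not> cell a b \<subseteq> cell a' b'"
      unfolding cell_subset_iff by blast
    then show "rel_interior S \<inter> rel_interior S' = {}"
      unfolding S by (rule disjoint_rel_interior_if_Int_proper_face[OF cell_Int_face])
  qed
  show "\<Union>{cell a b | a b. True} = solid"
    using Union_cells by blast
  show "\<forall>S\<in>{cell a b | a b. True}. \<forall>S'\<in>{cell a b | a b. True}.
      S \<inter> S' face_of S \<and> S \<inter> S' face_of S'"
  proof safe
    fix a b a' b'
    show "cell a b \<inter> cell a' b' face_of cell a b"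
      by (rule cell_Int_face)
    show "cell a b \<inter> cell a' b' face_of cell a' b'"
      using cell_Int_face[of a' b' a b] by (simp only: Int_commute)
  qed
qed

lemma centre_in_open_segment:
  assumes "i \<in> {1, 2, 3}"
  shows "c \<in> open_segment (apex True i) (apex False i)"
proof -
  have "c = (1 - 1 / 2) *\<^sub>R apex True i + (1 / 2) *\<^sub>R apex False i"
    by (simp add: apex_def algebra_simps flip: scaleR_left.add)
  moreover have "apex True i \<noteq> apex False i"
    using inj_apex[OF assms assms] by blast
  ultimately show ?thesis
    unfolding in_segment by (intro conjI exI[of _ "1 / 2"]) auto
qed

text \<open>
  The centre is an inner point of the diagonal \<open>i\<close>, so a face of \<open>S\<close> that
  contains the centre also contains both ends of this diagonal. A simplex \<open>S'\<close> around
  another diagonal contains the centre as well, but need not contain these ends.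
\<close>

lemma Int_not_face_if_different_diagonals:
  assumes i: "i \<in> {1, 2, 3}" and S: "{apex True i, apex False i} \<subseteq> S"
    and S': "c \<in> S'" "apex False i \<notin> S'" and "convex S"
  shows "\<not> S \<inter> S' face_of S"
proof
  assume "S \<inter> S' face_of S"
  moreover have "c \<in> S"
    using centre_in_open_segment[OF i] S \<open>convex S\<close>
    by (meson convex_contains_open_segment insert_subset subsetD)
  ultimately have "apex False i \<in> S \<inter> S'"
    using centre_in_open_segment[OF i] S S' unfolding face_of_def by blast
  with S' show False by simp
qed

end

section \<open>Cycles and connectedness in the underlying graph\<close>

text \<open>
  The form of cycles that is suitable for induction along the list and for checking concrete lists.
\<close>

lemma undirected_cycle_iff:
  "undirected_cycle G p \<longleftrightarrow>
    3 \<le> length p \<and> (\<exists>u\<in>pverts G. pcas u p u) \<and> distinct (map snd p) \<and>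
     (\<forall>(u, v) \<in> set p. (u, v) \<in> parcs G \<or> (v, u) \<in> parcs G)"
proof (cases "3 \<le> length p")
  case True
  have "pawalk_verts u p = u # map snd p" if "pcas u p v" for u v
    using that by (induction p arbitrary: u) auto
  then have distinct: "distinct (tl (pawalk_verts u p)) \<longleftrightarrow> distinct (map snd p)" if "pcas u p u" for u
    using that by simp
  have edges: "set p \<subseteq> parcs (mk_symmetric (with_proj G)) \<longleftrightarrow>
      (\<forall>(u, v) \<in> set p. (u, v) \<in> parcs G \<or> (v, u) \<in> parcs G)"
    by (force simp: parcs_mk_symmetric)
  have "p \<noteq> []"
    using True by auto
  then show ?thesis
    using True
    unfolding undirected_cycle_def pre_digraph.cycle_def pre_digraph.awalk_def
      cas_with_proj_eq awalk_verts_with_proj_eq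
      with_proj_simps pverts_mk_symmetric edges
    using distinct by blast
qed (simp add: undirected_cycle_def)

lemma sum_differences_pcas:
  fixes l :: "'a \<Rightarrow> int"
  assumes "pcas u p v"
  shows "(\<Sum>(x, y)\<leftarrow>p. l y - l x) = l v - l u"
  using assms by (induction p arbitrary: u) auto

text \<open>
  The differences of levels along a closed walk add up to zero; each forward edge contributes
  \<open>1\<close> and each backward edge \<open>- 1\<close>.
\<close>

lemma semi_balanced_if_level:
  fixes l :: "'a \<Rightarrow> int"
  assumes level: "\<And>t h. (t, h) \<in> parcs G \<Longrightarrow> l h = l t + 1"
  shows "semi_balanced G"
  unfolding semi_balanced_def
proof (intro allI impI)
  fix p assume "undirected_cycle G p"
  then obtain u where cas: "pcas u p u" and edges: "\<forall>(x, y)\<in>set p. (x, y) \<in> parcs G \<or> (y, x) \<in> parcs G"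
    by (auto simp: undirected_cycle_iff)
  have "(\<Sum>(x, y)\<leftarrow>p. l y - l x) =
      int (length (filter (\<lambda>(x, y). (x, y) \<in> parcs G) p)) -
      int (length (filter (\<lambda>(x, y). (y, x) \<in> parcs G) p))"
    using edges
  proof (induction p)
    case (Cons e p)
    obtain x y where e: "e = (x, y)" by fastforce
    have "(x, y) \<in> parcs G \<or> (y, x) \<in> parcs G" "\<not> ((x, y) \<in> parcs G \<and> (y, x) \<in> parcs G)"
      using Cons.prems level[of x y] level[of y x] by (auto simp: e)
    then consider "(x, y) \<in> parcs G" "(y, x) \<notin> parcs G" | "(y, x) \<in> parcs G" "(x, y) \<notin> parcs G"
      by blast
    then show ?case
      using Cons level[of x y] level[of y x] by cases (auto simp: e)
  qed simp
  with sum_differences_pcas[OF cas, of l]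
  show "length (filter (\<lambda>(x, y). (x, y) \<in> parcs G) p) =
      length (filter (\<lambda>(x, y). (y, x) \<in> parcs G) p)"
    by linarith
qed

lemma pcas_rotate1: "pcas u p u \<Longrightarrow> p \<noteq> [] \<Longrightarrow> \<exists>u'. pcas u' (rotate1 p) u'"
proof (cases p)
  case (Cons e q)
  have *: "pcas u (xs @ ys) v \<longleftrightarrow> (\<exists>w. pcas u xs w \<and> pcas w ys v)" for u v :: 'a and xs ys
    by (induction xs arbitrary: u) auto
  assume "pcas u p u"
  then show ?thesis by (auto simp: Cons *)
qed simp

lemma pcas_rotate: "pcas u p u \<Longrightarrow> p \<noteq> [] \<Longrightarrow> \<exists>u'. pcas u' (rotate n p) u'"
proof (induction n)
  case (Suc n)
  then obtain u' where "pcas u' (rotate n p) u'" by blast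
  with Suc.prems show ?case
    using pcas_rotate1[of u' "rotate n p"] by simp
qed auto

text \<open>
  A vertex of highest rank on a cycle would have two different neighbours of no higher rank, but
  each edge joins a vertex to its parent, so that only the parent qualifies.
\<close>

lemma acyclic_if_rank_parent:
  fixes rank :: "'a \<Rightarrow> nat"
  assumes parent: "\<And>t h. (t, h) \<in> A \<Longrightarrow>
    rank t < rank h \<and> t = parent h \<or> rank h < rank t \<and> h = parent t"
  shows "\<not> undirected_cycle \<lparr>pverts = V, parcs = A\<rparr> p"
proof
  have unique: "u = parent v" if "(u, v) \<in> A \<or> (v, u) \<in> A" "rank u \<le> rank v" for u v
    using that parent[of u v] parent[of v u] by auto
  assume "undirected_cycle \<lparr>pverts = V, parcs = A\<rparr> p"
  then obtain u where p: "3 \<le> length p" "pcas u p u" "distinct (map snd p)"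
    "\<And>x y. (x, y) \<in> set p \<Longrightarrow> (x, y) \<in> A \<or> (y, x) \<in> A"
    by (auto simp: undirected_cycle_iff)
  define m where "m = Max (rank ` set (map snd p))"
  have "m \<in> rank ` set (map snd p)"
    unfolding m_def using p(1) by (intro Max_in) auto
  then obtain e where e: "e \<in> set p" "rank (snd e) = m"
    by auto
  have max: "rank y \<le> rank (snd e)" if "y \<in> snd ` set p" for y
    unfolding e(2) m_def using that by (intro Max_ge) auto
  obtain n where n: "n < length p" "p ! n = e"
    using e(1) by (auto simp: in_set_conv_nth)
  \<comment> \<open>the cycle is rotated to start with the edge \<open>e\<close> that enters a vertex of highest rank\<close>
  define q where "q = rotate n p"
  have "hd q = e"
    using n p(1) hd_rotate_conv_nth[of p n] by (cases "p = []") (auto simp: q_def)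
  moreover have len: "3 \<le> length q" and set_q: "set q = set p" and dist: "distinct (map snd q)"
    using p by (simp_all add: q_def flip: rotate_map)
  \<comment> \<open>the third edge \<open>g\<close> is what separates the two neighbours \<open>fst e\<close> and \<open>snd f\<close> of that vertex\<close>
  ultimately obtain f g r where q: "q = e # f # g # r"
    by (cases q rule: remdups_adj.cases; cases "tl (tl q)") auto
  obtain u' where "pcas u' q u'"
    using pcas_rotate[OF p(2)] p(1) unfolding q_def by fastforce
  then have chain: "fst e = u'" "snd e = fst f" by (simp_all add: q)
  have last: "pcas a xs b \<Longrightarrow> xs \<noteq> [] \<Longrightarrow> snd (last xs) = b" for a b and xs :: "('a \<times> 'a) list"
    by (induction xs arbitrary: a) auto
  have closed: "fst e = snd (last q)"
    using last[OF \<open>pcas u' q u'\<close>] chain by (simp add: q)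
  then have start: "fst e \<in> snd ` set p"
    using set_q last_in_set[of q] by (force simp: q)
  have "e \<in> set p" "f \<in> set p"
    unfolding set_q[symmetric] q by simp_all
  have "(fst e, snd e) \<in> A \<or> (snd e, fst e) \<in> A"
    using p(4)[of "fst e" "snd e"] \<open>e \<in> set p\<close> by simp
  moreover have "(snd f, snd e) \<in> A \<or> (snd e, snd f) \<in> A"
    using p(4)[of "fst f" "snd f"] \<open>f \<in> set p\<close> by (auto simp: chain(2))
  ultimately have "fst e = snd f"
    using unique[of "fst e" "snd e"] unique[of "snd f" "snd e"] max start \<open>f \<in> set p\<close> by simp
  moreover have "snd (last q) \<noteq> snd f"
  proof -
    have "last q \<in> set (g # r)"
      by (auto simp: q)
    then have "snd (last q) \<in> snd ` set (g # r)"
      by (rule imageI)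
    moreover have "snd f \<notin> snd ` set (g # r)"
      using dist by (simp add: q)
    ultimately show ?thesis
      by metis
  qed
  ultimately show False using closed by simp
qed

lemma adjacent_if_connected:
  assumes "Digraph_Component.connected (with_proj \<lparr>pverts = V, parcs = A\<rparr>)" "x \<in> V" "y \<in> V" "x \<noteq> y"
  shows "\<exists>z. (x, z) \<in> A \<or> (z, x) \<in> A"
proof -
  let ?A = "parcs (mk_symmetric (with_proj \<lparr>pverts = V, parcs = A\<rparr>))"
  have "(x, y) \<in> rtrancl_on V ?A"
    using assms by (simp add: Digraph_Component.connected_def strongly_connected_def reachable_def)
  then have "(x, y) \<in> ?A\<^sup>*"
    by (rule rtrancl_on_rtranclI)
  then obtain z where "(x, z) \<in> ?A"
    using assms(4) by (auto elim: converse_rtranclE)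
  then show ?thesis
    by (auto simp: parcs_mk_symmetric)
qed

section \<open>Ribbon structures and tours\<close>

lemma cyclic_on_cycle_of_list:
  assumes "distinct cs" "cs \<noteq> []"
  shows "cyclic_on (cycle_of_list cs) (set cs)"
proof -
  have pow: "(cycle_of_list cs ^^ n) (cs ! 0) = cs ! (n mod length cs)" for n
  proof -
    have "(cycle_of_list cs ^^ n) (cs ! 0) = rotate n cs ! 0"
      using assms(2) by (simp flip: cyclic_rotation[OF assms(1)])
    then show ?thesis
      using assms(2) by (simp add: nth_rotate)
  qed
  have "set cs = orbit (cycle_of_list cs) (cs ! 0)"
  proof (intro equalityI subsetI)
    fix x assume "x \<in> set cs"
    then obtain i where i: "i < length cs" "x = cs ! i"
      by (auto simp: in_set_conv_nth)
    then have "x = (cycle_of_list cs ^^ (i + length cs)) (cs ! 0)"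
      by (simp only: pow) simp
    moreover have "0 < i + length cs"
      using assms(2) by simp
    ultimately show "x \<in> orbit (cycle_of_list cs) (cs ! 0)"
      unfolding orbit_altdef by blast
  next
    fix x assume "x \<in> orbit (cycle_of_list cs) (cs ! 0)"
    then show "x \<in> set cs"
      using assms(2) by (auto simp: orbit_altdef pow)
  qed
  then show ?thesis
    unfolding cyclic_on_def using assms(2) by (metis length_greater_0_conv nth_mem)
qed

text \<open>
  Tours are computed as lists of iterates of known length, which the simplifier can unfold; the
  period of the step function then has to be checked.
\<close>

definition iterates :: "('b \<Rightarrow> 'b) \<Rightarrow> 'b \<Rightarrow> nat \<Rightarrow> 'b list" where
  "iterates f b n = map (\<lambda>i. (f ^^ i) b) [0..<n]"

lemma iterates_rec: "iterates f b 0 = []" "iterates f b (Suc n) = b # iterates f (f b) n"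
  by (simp_all add: iterates_def upt_conv_Cons map_Suc_upt[symmetric] funpow_swap1 del: upt_Suc)

lemma iterates_numeral:
  "iterates f b (numeral v) = b # iterates f (f b) (pred_numeral v)"
  by (simp add: numeral_eq_Suc iterates_rec)

lemma tour_eq_iterates:
  assumes "0 < n" and closed: "last (iterates (tour_step \<rho> T) b (Suc n)) = b"
    and first: "b \<notin> set (tl (iterates (tour_step \<rho> T) b n))"
  shows "tour \<rho> b T = iterates (tour_step \<rho> T) b n"
proof -
  have period: "(tour_step \<rho> T ^^ n) b = b"
    using closed by (simp add: iterates_def)
  have "(LEAST m. 0 < m \<and> (tour_step \<rho> T ^^ m) b = b) = n"
  proof (rule Least_equality)
    fix m assume m: "0 < m \<and> (tour_step \<rho> T ^^ m) b = b"
    show "n \<le> m"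
    proof (rule ccontr)
      assume "\<not> n \<le> m"
      then have "b \<in> set (tl (iterates (tour_step \<rho> T) b n))"
        using m \<open>\<not> n \<le> m\<close> by (auto simp: iterates_def map_tl[symmetric] image_iff intro!: bexI[of _ m])
      with first show False by simp
    qed
  qed (use assms(1) period in simp)
  then show ?thesis by (simp add: tour_def iterates_def)
qed

lemma tour_nth:
  assumes "i < length (tour \<rho> b T)"
  shows "tour \<rho> b T ! i = (tour_step \<rho> T ^^ i) b"
    and "0 < i \<Longrightarrow> (tour_step \<rho> T ^^ i) b \<noteq> b"
  using assms not_less_Least[of i "\<lambda>n. 0 < n \<and> (tour_step \<rho> T ^^ n) b = b"] by (auto simp: tour_def)

text \<open>
  The base pair comes first in the tour, so no pair precedes it. If the base edge points to the base
  vertex, then its tail cannot come before its head.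
\<close>

lemma base_edge_in_jaeger_tree:
  assumes "jaeger_tree G \<rho> (h, (t, h)) T" "(t, h) \<in> parcs G"
  shows "(t, h) \<in> T"
proof (rule ccontr)
  assume "(t, h) \<notin> T"
  then have "precedes_in (tour \<rho> (h, (t, h)) T) (t, (t, h)) (h, (t, h))"
    using assms by (auto simp: jaeger_tree_def)
  then show False
    unfolding precedes_in_def using tour_nth(1,2) by (metis gr_zeroI not_less0)
qed

text \<open>
  If \<open>(t, h)\<close> is not in the tree, the step from \<open>(t, (t, h))\<close> stays at
  \<open>t\<close> and reaches the base pair: the tour ends there, with no room for the pair at
  \<open>h\<close>.
\<close>

lemma edge_before_base_in_jaeger_tree:
  assumes "jaeger_tree G \<rho> (t, e) T" "(t, h) \<in> parcs G" "\<rho> t (t, h) = e"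
  shows "(t, h) \<in> T"
proof (rule ccontr)
  assume nT: "(t, h) \<notin> T"
  then have "precedes_in (tour \<rho> (t, e) T) (t, (t, h)) (h, (t, h))"
    using assms by (auto simp: jaeger_tree_def)
  then obtain i j where ij: "i < j" "j < length (tour \<rho> (t, e) T)" "tour \<rho> (t, e) T ! i = (t, (t, h))"
    unfolding precedes_in_def by blast
  then have "(tour_step \<rho> T ^^ Suc i) (t, e) = (t, e)"
    using tour_nth(1)[of i \<rho> "(t, e)" T] nT assms(3) by (simp add: tour_step_def)
  moreover have "Suc i < length (tour \<rho> (t, e) T)"
    using ij by simp
  ultimately show False
    using tour_nth(2) by blast
qed

lemma precedes_in_Nil: "\<not> precedes_in [] x y"
  by (simp add: precedes_in_def)

lemma precedes_in_Cons: "precedes_in (z # zs) x y \<longleftrightarrow> z = x \<and> y \<in> set zs \<or> precedes_in zs x y"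
  (is "?l \<longleftrightarrow> ?r")
proof
  assume ?l
  then obtain i j where ij: "i < j" "j < Suc (length zs)" "(z # zs) ! i = x" "(z # zs) ! j = y"
    unfolding precedes_in_def by auto
  then obtain j' where j: "j = Suc j'"
    by (cases j) auto
  show ?r
  proof (cases i)
    case 0
    with ij j show ?thesis by auto
  next
    case (Suc i')
    with ij j show ?thesis
      unfolding precedes_in_def by auto
  qed
next
  assume ?r
  then show ?l
  proof
    assume "z = x \<and> y \<in> set zs"
    then obtain j where "j < length zs" "zs ! j = y" "z = x"
      by (auto simp: in_set_conv_nth)
    then show ?thesis
      unfolding precedes_in_def by (intro exI[of _ 0] exI[of _ "Suc j"]) auto
  next
    assume "precedes_in zs x y"
    then obtain i j where "i < j" "j < length zs" "zs ! i = x" "zs ! j = y"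
      unfolding precedes_in_def by auto
    then show ?thesis
      unfolding precedes_in_def by (intro exI[of _ "Suc i"] exI[of _ "Suc j"]) auto
  qed
qed

lemma tour_step_Pair: "tour_step \<rho> T (x, e) =
    (if e \<in> T then (other_end x e, \<rho> (other_end x e) e) else (x, \<rho> x e))"
  by (simp add: tour_step_def)

section \<open>Three paths of length two and their spanning trees\<close>

definition theta :: "nat pair_pre_digraph" where
  "theta = \<lparr>pverts = {0, 1, 2, 3, 4}, parcs = {(0, 1), (0, 2), (0, 3), (1, 4), (2, 4), (3, 4)}\<rparr>"

text \<open>The two halves of the path \<open>0 \<rightarrow> i \<rightarrow> 4\<close>, indexed by the sign of the corresponding octahedron vertex.\<close>

definition theta_arc :: "bool \<Rightarrow> nat \<Rightarrow> nat \<times> nat" where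
  "theta_arc a i = (if a then (0, i) else (i, 4))"

definition theta_tree :: "nat \<Rightarrow> nat \<Rightarrow> bool \<Rightarrow> nat \<Rightarrow> bool \<Rightarrow> (nat \<times> nat) set" where
  "theta_tree k i a j b = {theta_arc True k, theta_arc False k, theta_arc a i, theta_arc b j}"

text \<open>The edges at \<open>x\<close>, in the cyclic order of the ribbon structure.\<close>

definition theta_star :: "nat \<Rightarrow> (nat \<times> nat) list" where
  "theta_star x = (if x = 0 then [(0, 1), (0, 2), (0, 3)]
     else if x = 4 then [(1, 4), (2, 4), (3, 4)] else [(0, x), (x, 4)])"

definition theta_ribbon :: "nat \<Rightarrow> nat \<times> nat \<Rightarrow> nat \<times> nat" where
  "theta_ribbon x = cycle_of_list (theta_star x)"

text \<open>
  The path through \<open>k\<close> joins \<open>0\<close> and \<open>4\<close>, and one edge at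
  each other middle vertex joins it to one of them.
\<close>

lemma connected_theta:
  assumes "A \<subseteq> parcs theta" and full: "theta_arc True k \<in> A" "theta_arc False k \<in> A" "k \<in> {1, 2, 3}"
    and legs: "\<And>i. i \<in> {1, 2, 3} \<Longrightarrow> \<exists>a. theta_arc a i \<in> A"
  shows "Digraph_Component.connected (with_proj \<lparr>pverts = pverts theta, parcs = A\<rparr>)"
proof -
  let ?G = "with_proj (mk_symmetric (with_proj \<lparr>pverts = pverts theta, parcs = A\<rparr>))"
  interpret pair_wf_digraph "mk_symmetric (with_proj \<lparr>pverts = pverts theta, parcs = A\<rparr>)"
    using assms(1) by unfold_locales (auto simp: parcs_mk_symmetric theta_def)
  have edge: "x \<rightarrow>\<^sup>*\<^bsub>?G\<^esub> y \<and> y \<rightarrow>\<^sup>*\<^bsub>?G\<^esub> x" if "(x, y) \<in> A" for x y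
  proof -
    have "(x, y) \<in> parcs (mk_symmetric (with_proj \<lparr>pverts = pverts theta, parcs = A\<rparr>))"
      "(y, x) \<in> parcs (mk_symmetric (with_proj \<lparr>pverts = pverts theta, parcs = A\<rparr>))"
      using that by (auto simp: parcs_mk_symmetric intro!: bexI[of _ "(x, y)"])
    then show ?thesis
      by (intro conjI reachable_adjI) simp_all
  qed
  have "(0, k) \<in> A" "(k, 4) \<in> A"
    using full by (simp_all add: theta_arc_def)
  then have four: "4 \<rightarrow>\<^sup>*\<^bsub>?G\<^esub> 0" "0 \<rightarrow>\<^sup>*\<^bsub>?G\<^esub> 4"
    using edge reachable_trans by blast+
  have zero: "0 \<rightarrow>\<^sup>*\<^bsub>?G\<^esub> 0"
    by (rule reachable_refl) (simp add: theta_def)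
  have leg: "i \<rightarrow>\<^sup>*\<^bsub>?G\<^esub> 0 \<and> 0 \<rightarrow>\<^sup>*\<^bsub>?G\<^esub> i" if i: "i \<in> {1, 2, 3}" for i
  proof -
    obtain a where "theta_arc a i \<in> A"
      using legs[OF i] by blast
    then consider "(0, i) \<in> A" | "(i, 4) \<in> A"
      by (cases a) (auto simp: theta_arc_def)
    then show ?thesis
    proof cases
      case 1
      then show ?thesis using edge[of 0 i] by blast
    next
      case 2
      then show ?thesis using edge[of i 4] four reachable_trans by blast
    qed
  qed
  have star: "x \<rightarrow>\<^sup>*\<^bsub>?G\<^esub> 0 \<and> 0 \<rightarrow>\<^sup>*\<^bsub>?G\<^esub> x" if x: "x \<in> pverts theta" for x
  proof -
    consider "x = 0" | "x = 4" | "x \<in> {1, 2, 3}"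
      using x by (auto simp: theta_def)
    then show ?thesis
      using zero four leg by cases simp_all
  qed
  have "x \<rightarrow>\<^sup>*\<^bsub>?G\<^esub> y" if "x \<in> pverts theta" "y \<in> pverts theta" for x y
    using star[OF that(1)] star[OF that(2)] reachable_trans by blast
  moreover have "pverts theta \<noteq> {}"
    by (simp add: theta_def)
  ultimately show ?thesis
    by (simp add: Digraph_Component.connected_def strongly_connected_def)
qed

lemma incident_edges_theta: "x \<in> pverts theta \<Longrightarrow> incident_edges theta x = set (theta_star x)"
  by (auto simp: theta_def incident_edges_def theta_star_def)

lemma ribbon_structure_theta: "ribbon_structure theta theta_ribbon"
proof -
  have "distinct (theta_star x)" "theta_star x \<noteq> []" for x
    by (auto simp: theta_star_def)
  then show ?thesis
    using cycle_permutes[of "theta_star _"] cyclic_on_cycle_of_list[of "theta_star _"]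
    by (simp add: ribbon_structure_def incident_edges_theta theta_ribbon_def)
qed

lemma directed_graph_theta: "directed_graph theta"
proof -
  have "pair_digraph theta"
    by unfold_locales (auto simp: theta_def)
  then show ?thesis
    by (auto simp: directed_graph_def theta_def)
qed

lemma semi_balanced_theta: "semi_balanced theta"
  by (rule semi_balanced_if_level[of _ "\<lambda>x. if x = 0 then 0 else if x = 4 then 2 else 1"])
    (auto simp: theta_def)

lemma theta_arc_in_theta: "l \<in> {1, 2, 3} \<Longrightarrow> theta_arc s l \<in> parcs theta"
  by (auto simp: theta_def theta_arc_def)

lemma spanning_tree_theta_tree:
  assumes distinct: "k \<noteq> i" "k \<noteq> j" "i \<noteq> j" and kij: "{k, i, j} = {1, 2, 3}"
  shows "is_spanning_tree theta (theta_tree k i a j b)"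
proof -
  have in3: "k \<in> {1, 2, 3}" "i \<in> {1, 2, 3}" "j \<in> {1, 2, 3}"
    using kij by blast+
  have ends: "k \<noteq> 0" "i \<noteq> 0" "j \<noteq> 0" "k \<noteq> 4" "i \<noteq> 4" "j \<noteq> 4"
    using in3 by auto
  \<comment> \<open>the tree is rooted at \<open>0\<close>, with \<open>4\<close> below \<open>k\<close> and with \<open>i\<close> and \<open>j\<close> as leaves at \<open>0\<close> or \<open>4\<close>\<close>
  define rank where "rank = (\<lambda>x::nat. if x = 0 then 0 else if x = k then 1 else if x = 4 then 2 else x + 3)"
  define parent where "parent = (\<lambda>x. if x = 4 then k else if x = i then (if a then 0 else 4)
    else if x = j then (if b then 0 else 4) else 0)"
  have sub: "theta_tree k i a j b \<subseteq> parcs theta"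
    using in3 by (simp add: theta_tree_def theta_arc_in_theta)
  have legs: "\<exists>s. theta_arc s l \<in> theta_tree k i a j b" if l: "l \<in> {1, 2, 3}" for l
  proof -
    consider "l = k" | "l = i" | "l = j" using l unfolding kij[symmetric] by blast
    then show ?thesis
      by cases (unfold theta_tree_def, blast+)
  qed
  have "Digraph_Component.connected (with_proj \<lparr>pverts = pverts theta, parcs = theta_tree k i a j b\<rparr>)"
    by (rule connected_theta[OF sub _ _ in3(1) legs]) (auto simp: theta_tree_def)
  moreover have "\<not> undirected_cycle \<lparr>pverts = pverts theta, parcs = theta_tree k i a j b\<rparr> p" for p
  proof (rule acyclic_if_rank_parent[where rank = rank and parent = parent])
    fix t h assume "(t, h) \<in> theta_tree k i a j b"
    then show "rank t < rank h \<and> t = parent h \<or> rank h < rank t \<and> h = parent t"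
      using distinct distinct[symmetric] ends unfolding theta_tree_def theta_arc_def
      by (elim insertE emptyE) (cases a; cases b; simp add: rank_def parent_def)+
  qed
  ultimately show ?thesis
    using sub by (simp add: is_spanning_tree_def)
qed

lemma undirected_cycle_two_diagonals:
  assumes "{theta_arc True k, theta_arc False k, theta_arc True i, theta_arc False i} \<subseteq> A" "k \<noteq> i" "0 \<notin> {k, i}" "4 \<notin> {k, i}" "0 \<in> V"
  shows "undirected_cycle \<lparr>pverts = V, parcs = A\<rparr> [(0, k), (k, 4), (4, i), (i, 0)]"
  using assms by (auto simp: undirected_cycle_iff theta_arc_def)

text \<open>
  Connectedness forces an edge at each middle vertex, and a second complete path would close a cycle
  with the one through \<open>k\<close>.
\<close>

lemma spanning_tree_theta_cases:
  assumes T: "is_spanning_tree theta T" and k: "theta_arc True k \<in> T" "theta_arc False k \<in> T"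
    and distinct: "k \<noteq> i" "k \<noteq> j" "i \<noteq> j" and kij: "{k, i, j} = {1, 2, 3}"
  shows "\<exists>a b. T = theta_tree k i a j b"
proof -
  have in3: "k \<in> {1, 2, 3}" "i \<in> {1, 2, 3}" "j \<in> {1, 2, 3}"
    using kij by blast+
  have sub: "T \<subseteq> parcs theta" and acyclic: "\<And>p. \<not> undirected_cycle \<lparr>pverts = pverts theta, parcs = T\<rparr> p"
    using T by (auto simp: is_spanning_tree_def)
  have "theta_arc True l \<in> T \<or> theta_arc False l \<in> T" if l: "l \<in> {1, 2, 3}" for l
  proof -
    have "l \<in> pverts theta" "0 \<in> pverts theta" "l \<noteq> 0"
      using l by (auto simp: theta_def)
    then obtain z where "(l, z) \<in> T \<or> (z, l) \<in> T"
      using adjacent_if_connected[of "pverts theta" T l 0] T by (auto simp: is_spanning_tree_def)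
    moreover have "z = 4" if "(l, z) \<in> T"
      using that sub \<open>l \<noteq> 0\<close> by (auto simp: theta_def)
    moreover have "z = 0" if "(z, l) \<in> T"
      using that sub l by (auto simp: theta_def)
    ultimately show ?thesis
      by (auto simp: theta_arc_def)
  qed
  moreover have "\<not> (theta_arc True l \<in> T \<and> theta_arc False l \<in> T)" if "l \<in> {1, 2, 3}" "k \<noteq> l" for l
    using acyclic undirected_cycle_two_diagonals[of k l T "pverts theta"] k in3(1) that
    by (auto simp: theta_def)
  ultimately obtain a b where ab: "theta_arc a i \<in> T" "theta_arc (\<not> a) i \<notin> T" "theta_arc b j \<in> T" "theta_arc (\<not> b) j \<notin> T"
    using in3 distinct by metis
  have "parcs theta = (\<Union>l\<in>{1, 2, 3}. {theta_arc True l, theta_arc False l})"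
    by (auto simp: theta_def theta_arc_def)
  also have "\<dots> = {theta_arc True k, theta_arc False k, theta_arc a i, theta_arc (\<not> a) i, theta_arc b j, theta_arc (\<not> b) j}"
    unfolding kij[symmetric] by (cases a; cases b) auto
  finally have "T = theta_tree k i a j b"
    using sub k ab by (auto simp: theta_tree_def)
  then show ?thesis by blast
qed

section \<open>Jaeger trees for the two bases\<close>

lemma theta_ribbon_eqs:
  "theta_ribbon 0 (0, 1) = (0, 2)" "theta_ribbon 0 (0, 2) = (0, 3)" "theta_ribbon 0 (0, 3) = (0, 1)"
  "theta_ribbon 4 (1, 4) = (2, 4)" "theta_ribbon 4 (2, 4) = (3, 4)" "theta_ribbon 4 (3, 4) = (1, 4)"
  "x \<noteq> 0 \<Longrightarrow> x \<noteq> 4 \<Longrightarrow> theta_ribbon x (0, x) = (x, 4)" "x \<noteq> 0 \<Longrightarrow> x \<noteq> 4 \<Longrightarrow> theta_ribbon x (x, 4) = (0, x)"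
  by (simp_all add: theta_ribbon_def theta_star_def transpose_def)

lemmas tour_simps = iterates_rec iterates_numeral tour_step_Pair theta_ribbon_eqs[unfolded One_nat_def] other_end_def theta_tree_def theta_arc_def
  precedes_in_Nil precedes_in_Cons

text \<open>
  The tour of a spanning tree goes through all pairs of a vertex and an incident edge, that is,
  twice through each of the six edges. What remains to be checked for a concrete tree is a
  computation.
\<close>

lemma jaeger_tree_12_steps:
  assumes "is_spanning_tree theta T"
    and "last (iterates (tour_step theta_ribbon T) b (Suc 12)) = b"
    and "b \<notin> set (tl (iterates (tour_step theta_ribbon T) b 12))"
    and "\<forall>(t, h) \<in> parcs theta. (t, h) \<in> T \<or>
      precedes_in (iterates (tour_step theta_ribbon T) b 12) (t, (t, h)) (h, (t, h))"
  shows "jaeger_tree theta theta_ribbon b T"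
  using assms tour_eq_iterates[of 12 theta_ribbon T b] by (auto simp: jaeger_tree_def)

lemma jaeger_tree_incoming_base: "jaeger_tree theta theta_ribbon (1, (0, 1)) (theta_tree 1 2 a 3 b)"
proof (rule jaeger_tree_12_steps)
  show "is_spanning_tree theta (theta_tree 1 2 a 3 b)"
    by (rule spanning_tree_theta_tree) auto
  show "last (iterates (tour_step theta_ribbon (theta_tree 1 2 a 3 b)) (1, (0, 1)) (Suc 12)) = (1, (0, 1))"
    by (cases a; cases b) (simp_all add: tour_simps)
  show "(1, (0, 1)) \<notin> set (tl (iterates (tour_step theta_ribbon (theta_tree 1 2 a 3 b)) (1, (0, 1)) 12))"
    by (cases a; cases b) (simp_all add: tour_simps)
  show "\<forall>(t, h) \<in> parcs theta. (t, h) \<in> theta_tree 1 2 a 3 b \<or>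
      precedes_in (iterates (tour_step theta_ribbon (theta_tree 1 2 a 3 b)) (1, (0, 1)) 12) (t, (t, h)) (h, (t, h))"
    by (cases a; cases b) (simp_all add: theta_def tour_simps)
qed

text \<open>
  At the vertex \<open>1\<close> of degree two, the base edge \<open>01\<close> is the edge
  following \<open>14\<close>. So one of the edges of the path through \<open>1\<close> is in every
  Jaeger tree for being first, the other one for being last.
\<close>

lemma jaeger_trees_incoming_base: "{T. jaeger_tree theta theta_ribbon (1, (0, 1)) T} = {theta_tree 1 2 a 3 b | a b. True}"
proof (intro equalityI subsetI)
  fix T assume "T \<in> {T. jaeger_tree theta theta_ribbon (1, (0, 1)) T}"
  then have J: "jaeger_tree theta theta_ribbon (1, (0, 1)) T" by simp
  have "(0, 1) \<in> T"
    by (rule base_edge_in_jaeger_tree[OF J]) (simp add: theta_def)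
  moreover have "(1, 4) \<in> T"
    by (rule edge_before_base_in_jaeger_tree[OF J]) (simp_all add: theta_def theta_ribbon_eqs[unfolded One_nat_def])
  ultimately show "T \<in> {theta_tree 1 2 a 3 b | a b. True}"
    using spanning_tree_theta_cases[of T 1 2 3] J by (auto simp: jaeger_tree_def theta_arc_def)
next
  fix T assume "T \<in> {theta_tree 1 2 a 3 b | a b. True}"
  then show "T \<in> {T. jaeger_tree theta theta_ribbon (1, (0, 1)) T}"
    using jaeger_tree_incoming_base by blast
qed

text \<open>
  Neither argument applies when the base edge leaves the base vertex. Now the Jaeger trees that
  contain \<open>01\<close> but not \<open>14\<close> go through \<open>3\<close>, and those that
  contain \<open>14\<close> but not \<open>01\<close> go through \<open>2\<close>. So the square
  spanned by the diagonals \<open>2\<close> and \<open>3\<close> is cut along different diagonals on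
  its two sides. One tree on either side is enough.
\<close>

lemma jaeger_tree_outgoing_base_diagonal_3: "jaeger_tree theta theta_ribbon (1, (1, 4)) (theta_tree 3 1 True 2 True)"
proof (rule jaeger_tree_12_steps)
  show "is_spanning_tree theta (theta_tree 3 1 True 2 True)"
    by (rule spanning_tree_theta_tree) auto
qed (simp_all add: theta_def tour_simps)

lemma jaeger_tree_outgoing_base_diagonal_2: "jaeger_tree theta theta_ribbon (1, (1, 4)) (theta_tree 2 1 False 3 True)"
proof (rule jaeger_tree_12_steps)
  show "is_spanning_tree theta (theta_tree 2 1 False 3 True)"
    by (rule spanning_tree_theta_tree) auto
qed (simp_all add: theta_def tour_simps)

section \<open>The root polytope is an octahedron\<close>

lemma lookup_scaleR [simp]:
  fixes x :: "'a \<Rightarrow>\<^sub>0 real"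
  shows "Poly_Mapping.lookup (r *\<^sub>R x) i = r * Poly_Mapping.lookup x i"
proof -
  have "finite {j. r *\<^sub>R Poly_Mapping.lookup x j \<noteq> 0}"
    by (rule finite_subset[OF _ finite_lookup[of x]]) auto
  then show ?thesis
    by (simp add: scaleR_poly_mapping_def Abs_poly_mapping_inverse)
qed

text \<open>
  The centre and the half diagonals of the octahedron have been chosen such that the coordinate of a
  point along the diagonal \<open>i\<close> is simply its component at the vertex \<open>i\<close>.
\<close>

definition centre :: "nat \<Rightarrow>\<^sub>0 real" where
  "centre = (1 / 2) *\<^sub>R (Poly_Mapping.single 4 1 - Poly_Mapping.single 0 1)"

definition half_diagonal :: "nat \<Rightarrow> nat \<Rightarrow>\<^sub>0 real" where
  "half_diagonal i = Poly_Mapping.single i 1 - (1 / 2) *\<^sub>R (Poly_Mapping.single 0 1 + Poly_Mapping.single 4 1)"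

interpretation theta: octahedron centre half_diagonal "\<lambda>i x. Poly_Mapping.lookup x i"
proof unfold_locales
  show "Poly_Mapping.lookup (x + y) i = Poly_Mapping.lookup x i + Poly_Mapping.lookup y i"
    and "Poly_Mapping.lookup (r *\<^sub>R x) i = r *\<^sub>R Poly_Mapping.lookup x i"
    for i :: nat and x y :: "nat \<Rightarrow>\<^sub>0 real" and r
    by (simp_all add: lookup_add)
  show "Poly_Mapping.lookup centre i = 0" if "i \<in> {1, 2, 3}" for i
    using that by (auto simp: centre_def lookup_minus lookup_single lookup_one)
  show "Poly_Mapping.lookup (half_diagonal j) i = of_bool (i = j)"
    if "i \<in> {1, 2, 3}" "j \<in> {1, 2, 3}" for i j
    using that by (auto simp: half_diagonal_def lookup_minus lookup_add lookup_single lookup_one)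
qed

lemma edge_vector_theta_arc: "edge_vector (theta_arc a i) = theta.apex a i"
  unfolding theta.apex_def
  by (rule poly_mapping_eqI, cases a)
    (simp_all add: edge_vector_def theta_arc_def centre_def half_diagonal_def
      lookup_minus lookup_add lookup_single lookup_one when_def)

lemma root_polytope_theta_tree:
  "root_polytope (theta_tree k i a j b) =
    convex hull {theta.apex True k, theta.apex False k, theta.apex a i, theta.apex b j}"
  by (simp add: root_polytope_def theta_tree_def edge_vector_theta_arc)

lemma root_polytope_theta: "root_polytope (parcs theta) = theta.solid"
proof -
  have "parcs theta = {theta_arc a i | a i. i \<in> {1, 2, 3}}"
    by (auto simp: theta_def theta_arc_def)
  then have "edge_vector ` parcs theta = {theta.apex a i | a i. i \<in> {1, 2, 3}}"
    by (force simp flip: edge_vector_theta_arc)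
  then show ?thesis
    by (simp add: root_polytope_def theta.solid_def)
qed

lemma triangulation_incoming_base:
  "triangulation_of (jaeger_simplices theta theta_ribbon (1, (0, 1))) (root_polytope (parcs theta))"
proof -
  have "jaeger_simplices theta theta_ribbon (1, (0, 1)) = {theta.cell a b | a b. True}"
    unfolding jaeger_simplices_def jaeger_trees_incoming_base theta.cell_def root_polytope_theta_tree[symmetric]
    by blast
  then show ?thesis
    using theta.triangulation_cells by (simp add: root_polytope_theta)
qed

lemma no_triangulation_outgoing_base:
  "\<not> triangulation_of (jaeger_simplices theta theta_ribbon (1, (1, 4))) (root_polytope (parcs theta))"
proof
  let ?S = "root_polytope (theta_tree 3 1 True 2 True)" and ?S' = "root_polytope (theta_tree 2 1 False 3 True)"
  assume "triangulation_of (jaeger_simplices theta theta_ribbon (1, (1, 4))) (root_polytope (parcs theta))"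
  then have face: "?S \<inter> ?S' face_of ?S"
    using jaeger_tree_outgoing_base_diagonal_3 jaeger_tree_outgoing_base_diagonal_2
    by (auto simp: triangulation_of_def jaeger_simplices_def)
  have in_hull: "{theta.apex True k, theta.apex False k} \<subseteq> root_polytope (theta_tree k i a j b)" for k i a j b
    unfolding root_polytope_theta_tree by (auto intro: hull_inc)
  have centre: "centre \<in> ?S'"
    using theta.centre_in_open_segment[of 2] in_hull[of 2 1 False 3 True] convex_contains_open_segment[of ?S']
    by (auto simp: root_polytope_theta_tree)
  \<comment> \<open>only the positive end of the diagonal 3 belongs to the second simplex\<close>
  have "?S' \<subseteq> {x. 0 \<le> Poly_Mapping.lookup x 3}"
    unfolding root_polytope_theta_tree
    by (rule hull_minimal) (auto simp: theta.coord_apex intro: theta.convex_halfspace[of 3 1, simplified])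
  moreover have "Poly_Mapping.lookup (theta.apex False 3) 3 = - 1"
    by (simp add: theta.coord_apex)
  ultimately have "theta.apex False 3 \<notin> ?S'"
    by auto
  then have "\<not> ?S \<inter> ?S' face_of ?S"
    using in_hull centre by (intro theta.Int_not_face_if_different_diagonals[of 3]) (auto simp: root_polytope_theta_tree)
  with face show False by blast
qed

theorem proposition10p5:
  shows "\<exists>(G :: nat pair_pre_digraph) \<rho> b b'.
     directed_graph G \<and> Digraph_Component.connected (with_proj G) \<and> semi_balanced G \<and>
     ribbon_structure G \<rho> \<and> is_basis G b \<and> is_basis G b' \<and>
     triangulation_of (jaeger_simplices G \<rho> b) (root_polytope (parcs G)) \<and>
     \<not> triangulation_of (jaeger_simplices G \<rho> b') (root_polytope (parcs G))"
proof -
  have "Digraph_Component.connected (with_proj \<lparr>pverts = pverts theta, parcs = parcs theta\<rparr>)"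
    using theta_arc_in_theta by (intro connected_theta[of _ 1]) auto
  then have "Digraph_Component.connected (with_proj theta)"
    by (simp add: theta_def)
  moreover have "is_basis theta (1, (0, 1))" "is_basis theta (1, (1, 4))"
    by (simp_all add: is_basis_def incident_edges_def theta_def)
  ultimately show ?thesis
    using directed_graph_theta semi_balanced_theta ribbon_structure_theta triangulation_incoming_base no_triangulation_outgoing_base
    by blast
qed

end
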